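(* Let $q$ be a power of a prime $p$, let $\mathcal{T}$ be a multiset of points of $\mathrm{AG}(2,q)$, let $\lambda$ be an integer, and let $\mathcal{E}_\lambda$ be a set of $(q-\lambda)$-uniform directions w.r.t. $\mathcal{T}$, of size at most $q$. For $(d)\in\mathcal{E}_\lambda$ let $m_d$ denote the typical intersection number at $(d)$. Assume that: (i) $0<\lambda\le \min\{q-2,p-1\}$; (ii) for each $(d)\in\mathcal{E}_\lambda$ the renitent lines with slope $d$ all meet $\mathcal{T}$ in the same number, say $t_d$, of points modulo $p$; (iii) the value of $t_d-m_d$ modulo $p$ does not depend on the choice of $(d)\in\mathcal{E}_\lambda$. Then the renitent lines with direction in $\mathcal{E}_\lambda$ are contained in an algebraic envelope of class $\lambda$.
   Context: $\mathrm{AG}(2,q)$ is the desarguesian affine plane over $\mathbb{F}_q$, embedded in $\mathrm{PG}(2,q)$ as the set of points $(a:b:1)$; the line at infinity is $\ell_\infty=[0:0:1]$. Here $[u:v:w]$ denotes the line $\{(x:y:z): ux+vy+wz=0\}$. The points of $\ell_\infty$ are called directions: $(d)=(1:d:0)$ for $d\in\mathbb{F}_q$ and $(\infty)=(0:1:0)$. The affine lines with slope (direction) $d$ are the $q$ affine lines through $(d)$. Multisets are finite, and intersection sizes with $\mathcal{T}$ are counted with multiplicity. A direction $(d)$ is $(q-\lambda)$-uniform w.r.t. $\mathcal{T}$ if at least $q-\lambda$ affine lines with slope $d$ meet $\mathcal{T}$ in the same number of points modulo $p$; this number (modulo $p$) is the typical intersection number at $(d)$. If it is not uniquely determined, one such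 number is fixed for $(d)$. The other affine lines with slope $d$ (those whose intersection size with $\mathcal{T}$ is not congruent to the typical intersection number modulo $p$) are called renitent. An algebraic envelope of class $n$ is a curve of degree $n$ in the dual plane, i.e. it is given by a nonzero homogeneous polynomial $g\in\mathbb{F}_q[U,V,W]$ of degree $n$; a line $[u:v:w]$ is contained in it if $g(u,v,w)=0$. *)

theory Defs
  imports
    "HOL-Library.Cardinality"
    "HOL-Library.Multiset"
    "HOL-Library.Poly_Mapping"
    "HOL-Library.Product_Plus"
    "HOL-Number_Theory.Cong"
begin

text \<open>The field is a type \<open>'a\<close> of class \<open>{field, finite}\<close>, and \<open>q\<close> is its cardinality. A point of
  \<open>PG(2,q)\<close> is the class of its homogeneous coordinates, represented as a set of triples.\<close>

type_synonym 'a point = "('a \<times> 'a \<times> 'a) set"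

definition proj_point :: "'a::field \<Rightarrow> 'a \<Rightarrow> 'a \<Rightarrow> 'a point" where
  "proj_point x y z = {(c * x, c * y, c * z) | c. c \<noteq> 0}"

text \<open>\<open>proj_line u v w\<close> is \<open>[u:v:w]\<close> as a set of points; it is a line when \<open>(u, v, w)\<close> is nonzero.\<close>

definition proj_line :: "'a::field \<Rightarrow> 'a \<Rightarrow> 'a \<Rightarrow> 'a point set" where
  "proj_line u v w =
    {proj_point x y z | x y z. (x, y, z) \<noteq> (0, 0, 0) \<and> u * x + v * y + w * z = 0}"

definition affine_points :: "'a::field point set" where
  "affine_points = {proj_point a b 1 | a b. True}"

definition line_at_infinity :: "'a::field point set" where
  "line_at_infinity = proj_line 0 0 1"

text \<open>The directions are the points of \<open>line_at_infinity\<close>; \<open>affine_lines d\<close> is the set of affine lines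
  with slope \<open>d\<close>, each together with its point at infinity \<open>d\<close>.\<close>

definition affine_lines :: "'a::field point \<Rightarrow> 'a point set set" where
  "affine_lines d =
    {proj_line u v w | u v w. (u, v, w) \<noteq> (0, 0, 0) \<and> d \<in> proj_line u v w} - {line_at_infinity}"

lemma line_at_infinity_eq:
  "line_at_infinity = insert (proj_point 0 1 0) (range (\<lambda>d::'a::field. proj_point 1 d 0))"
proof
  show "line_at_infinity \<subseteq> insert (proj_point 0 1 0) (range (\<lambda>d::'a. proj_point 1 d 0))"
  proof
    fix P :: "'a point" assume "P \<in> line_at_infinity"
    then obtain x y where P: "P = proj_point x y 0" and nz: "x \<noteq> 0 \<or> y \<noteq> 0"
      by (auto simp: line_at_infinity_def proj_line_def)
    show "P \<in> insert (proj_point 0 1 0) (range (\<lambda>d::'a. proj_point 1 d 0))"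
    proof (cases "x = 0")
      case True
      have "(\<exists>c. b = c * y \<and> c \<noteq> 0) \<longleftrightarrow> b \<noteq> 0" for b
        using True nz by (auto intro!: exI[of _ "b / y"])
      then have "P = proj_point 0 1 0"
        using True unfolding P proj_point_def by auto
      then show ?thesis by simp
    next
      case False
      have "(\<exists>c. a = c * x \<and> b = c * y \<and> c \<noteq> 0) \<longleftrightarrow> (b = a * (y / x) \<and> a \<noteq> 0)" for a b
        using False by (auto intro!: exI[of _ "a / x"])
      then have "P = proj_point 1 (y / x) 0"
        unfolding P proj_point_def by auto
      then show ?thesis by simp
    qed
  qed
next
  have "proj_point x y 0 \<in> line_at_infinity" if "(x, y) \<noteq> (0, 0)" for x y :: 'a
    unfolding line_at_infinity_def proj_line_def using that
    by (intro CollectI exI[of _ x] exI[of _ y] exI[of _ "0::'a"]) auto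
  then show "insert (proj_point 0 1 0) (range (\<lambda>d::'a. proj_point 1 d 0)) \<subseteq> line_at_infinity"
    by auto
qed

definition intersection_size :: "'a point multiset \<Rightarrow> 'a point set \<Rightarrow> nat" where
  "intersection_size T l = size (filter_mset (\<lambda>P. P \<in> l) T)"

text \<open>\<open>typical p lam T d m\<close>: the residue of \<open>m\<close> modulo \<open>p\<close> is an admissible typical intersection
  number at the \<open>(q - lam)\<close>-uniform direction \<open>d\<close>. It need not be unique.\<close>

definition typical ::
  "nat \<Rightarrow> int \<Rightarrow> 'a::{field, finite} point multiset \<Rightarrow> 'a point \<Rightarrow> int \<Rightarrow> bool" where
  "typical p lam T d m \<longleftrightarrow>
    int (card {l \<in> affine_lines d. [int (intersection_size T l) = m] (mod int p)})
      \<ge> int CARD('a) - lam"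

definition uniform_direction ::
  "nat \<Rightarrow> int \<Rightarrow> 'a::{field, finite} point multiset \<Rightarrow> 'a point \<Rightarrow> bool" where
  "uniform_direction p lam T d \<longleftrightarrow> d \<in> line_at_infinity \<and> (\<exists>m. typical p lam T d m)"

definition renitent_lines ::
  "nat \<Rightarrow> 'a::field point multiset \<Rightarrow> 'a point \<Rightarrow> int \<Rightarrow> 'a point set set" where
  "renitent_lines p T d m =
    {l \<in> affine_lines d. \<not> [int (intersection_size T l) = m] (mod int p)}"

text \<open>Polynomials in \<open>U, V, W\<close>: finitely supported maps from exponent triples \<open>(i, j, k)\<close>, standing
  for the monomial \<open>U^i V^j W^k\<close>, to coefficients.\<close>

type_synonym 'a poly3 = "(nat \<times> nat \<times> nat) \<Rightarrow>\<^sub>0 'a"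

definition eval3 :: "'a::comm_semiring_1 poly3 \<Rightarrow> 'a \<Rightarrow> 'a \<Rightarrow> 'a \<Rightarrow> 'a" where
  "eval3 g u v w =
    (\<Sum>(i, j, k)\<in>Poly_Mapping.keys g. Poly_Mapping.lookup g (i, j, k) * u ^ i * v ^ j * w ^ k)"

definition homogeneous3 :: "nat \<Rightarrow> 'a::zero poly3 \<Rightarrow> bool" where
  "homogeneous3 n g \<longleftrightarrow> (\<forall>(i, j, k)\<in>Poly_Mapping.keys g. i + j + k = n)"

definition algebraic_envelope :: "nat \<Rightarrow> 'a::zero poly3 \<Rightarrow> bool" where
  "algebraic_envelope n g \<longleftrightarrow> g \<noteq> 0 \<and> homogeneous3 n g"

text \<open>For homogeneous \<open>g\<close> the condition does not depend on the coordinates \<open>(u, v, w)\<close> chosen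
  for the line.\<close>

definition envelope_lines :: "'a::field poly3 \<Rightarrow> 'a point set set" where
  "envelope_lines g = {proj_line u v w | u v w. (u, v, w) \<noteq> (0, 0, 0) \<and> eval3 g u v w = 0}"

end

theory Submission
  imports
    Defs
    "HOL-Computational_Algebra.Polynomial"
    "HOL-Computational_Algebra.Formal_Power_Series"
    "HOL-Number_Theory.Residues"
begin

text \<open>Fix a direction \<open>(v : -u : 0)\<close> of \<open>E\<close>. Its affine lines are \<open>[u : v : w]\<close>, and the one through the
  point \<open>(a : b : 1)\<close> has \<open>w = -(u a + v b)\<close>. Hence, with \<open>s = t d - m d\<close>, the sum of
  \<open>(-(u a + v b))^k\<close> over \<open>T\<close> equals \<open>m d\<close> times the sum of \<open>w^k\<close> over the whole field, which vanishes
  for \<open>0 < k < q - 1\<close>, plus \<open>s\<close> times the \<open>k\<close>-th power sum of the renitent \<open>w\<close>. Since \<open>s\<close> is a nonzero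
  constant, these power sums are forms of degree \<open>k\<close> in \<open>u, v\<close>. By Newton's identities, which may be
  solved up to \<open>lam < p\<close>, so are the coefficients of the product of \<open>1 - w X\<close> over the renitent \<open>w\<close>.
  The reversal of this polynomial to degree \<open>lam\<close> in \<open>W\<close> is the envelope: it is nonzero because it
  takes the value \<open>1\<close> at \<open>(0, 0, 1)\<close>.\<close>

unbundle fps_syntax

section \<open>Evaluation and homogeneity of polynomials in three variables\<close>

lemma eval3_superset:
  assumes "finite S" "Poly_Mapping.keys g \<subseteq> S"
  shows "eval3 g u v w = (\<Sum>(i, j, k)\<in>S. Poly_Mapping.lookup g (i, j, k) * u ^ i * v ^ j * w ^ k)"
  unfolding eval3_def using assms
  by (intro sum.mono_neutral_left) (auto simp: in_keys_iff)

lemma eval3_add: "eval3 (f + g) u v w = eval3 f u v w + eval3 g u v w"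
proof -
  let ?S = "Poly_Mapping.keys f \<union> Poly_Mapping.keys g"
  have "finite ?S" by simp
  then show ?thesis
    using Poly_Mapping.keys_add[of f g]
    by (simp add: eval3_superset[of ?S] lookup_add case_prod_unfold distrib_right sum.distrib)
qed

lemma eval3_0 [simp]: "eval3 0 u v w = 0"
  by (simp add: eval3_def)

lemma eval3_single [simp]: "eval3 (Poly_Mapping.single (i, j, k) c) u v w = c * u ^ i * v ^ j * w ^ k"
  by (subst eval3_superset[of "{(i, j, k)}"]) auto

lemma eval3_sum: "eval3 (\<Sum>x\<in>A. f x) u v w = (\<Sum>x\<in>A. eval3 (f x) u v w)"
  by (induction A rule: infinite_finite_induct) (auto simp: eval3_add)

lemma eval3_sum_mset: "eval3 (\<Sum>x\<in>#M. f x) u v w = (\<Sum>x\<in>#M. eval3 (f x) u v w)"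
  by (induction M) (auto simp: eval3_add)

lemma poly_mapping_sum_single:
  "f = (\<Sum>k\<in>Poly_Mapping.keys f. Poly_Mapping.single k (Poly_Mapping.lookup f k))"
  by (rule poly_mapping_eqI) (auto simp: lookup_sum lookup_single when_def in_keys_iff)

text \<open>Both sides are bilinear in \<open>f\<close> and \<open>g\<close>, so expanding into
  monomials reduces the claim to two monomials, whose exponents add.\<close>

lemma eval3_mult: "eval3 (f * g) u v w = eval3 f u v w * eval3 g u v w"
proof -
  have single: "eval3 (Poly_Mapping.single a c * Poly_Mapping.single b d) u v w
      = eval3 (Poly_Mapping.single a c) u v w * eval3 (Poly_Mapping.single b d) u v w"
    for a b :: "nat \<times> nat \<times> nat" and c d
    by (cases a; cases b) (simp add: mult_single power_add algebra_simps)
  let ?m = "\<lambda>f a. Poly_Mapping.single a (Poly_Mapping.lookup f a)"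
  have eval: "eval3 h u v w = (\<Sum>a\<in>Poly_Mapping.keys h. eval3 (?m h a) u v w)" for h
    using arg_cong[OF poly_mapping_sum_single[of h], of "\<lambda>h. eval3 h u v w"]
    by (simp only: eval3_sum)
  have "f * g = (\<Sum>a\<in>Poly_Mapping.keys f. \<Sum>b\<in>Poly_Mapping.keys g. ?m f a * ?m g b)"
    using arg_cong2[OF poly_mapping_sum_single[of f] poly_mapping_sum_single[of g], of "(*)"]
    by (simp only: sum_product)
  then have "eval3 (f * g) u v w = (\<Sum>a\<in>Poly_Mapping.keys f. \<Sum>b\<in>Poly_Mapping.keys g.
      eval3 (?m f a) u v w * eval3 (?m g b) u v w)"
    by (simp only: eval3_sum single)
  then show ?thesis
    by (simp only: eval[of f] eval[of g] sum_product)
qed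

lemma eval3_1 [simp]: "eval3 1 u v w = 1"
  using eval3_single[of 0 0 0 1 u v w] by (simp flip: zero_prod_def)

lemma eval3_power: "eval3 (f ^ n) u v w = eval3 f u v w ^ n"
  by (induction n) (auto simp: eval3_mult)

text \<open>Zero counts as a form of every degree, so cancellation in sums needs no separate
  treatment; nonvanishing is proved at the end by evaluating at one point.\<close>

lemma homogeneous3_0 [simp]: "homogeneous3 n 0"
  by (simp add: homogeneous3_def)

lemma homogeneous3_1 [simp]: "homogeneous3 0 1"
  by (simp add: homogeneous3_def zero_prod_def)

lemma homogeneous3_add: "homogeneous3 n f \<Longrightarrow> homogeneous3 n g \<Longrightarrow> homogeneous3 n (f + g)"
  using Poly_Mapping.keys_add[of f g] by (fastforce simp: homogeneous3_def)

lemma homogeneous3_mult: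
  assumes "homogeneous3 m f" "homogeneous3 n g"
  shows "homogeneous3 (m + n) (f * g)"
  using assms keys_mult[of f g] unfolding homogeneous3_def by fastforce

lemma homogeneous3_power: "homogeneous3 m f \<Longrightarrow> homogeneous3 (n * m) (f ^ n)"
  by (induction n) (auto intro: homogeneous3_mult)

lemma homogeneous3_sum: "(\<And>x. x \<in> A \<Longrightarrow> homogeneous3 n (f x)) \<Longrightarrow> homogeneous3 n (\<Sum>x\<in>A. f x)"
  by (induction A rule: infinite_finite_induct) (auto intro: homogeneous3_add)

lemma homogeneous3_sum_mset:
  "(\<And>x. x \<in># M \<Longrightarrow> homogeneous3 n (f x)) \<Longrightarrow> homogeneous3 n (\<Sum>x\<in>#M. f x)"
  by (induction M) (auto intro: homogeneous3_add)

lemma homogeneous3_single: "i + j + k = n \<Longrightarrow> homogeneous3 n (Poly_Mapping.single (i, j, k) c)"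
  by (auto simp: homogeneous3_def)

lemma algebraic_envelopeI:
  assumes "homogeneous3 n g" "eval3 g u v w \<noteq> 0"
  shows "algebraic_envelope n g"
  using assms by (auto simp: algebraic_envelope_def)

section \<open>The product of the factors 1 - w X and Newton's identities\<close>

text \<open>For finite \<open>R\<close> the k-th coefficient is (-1)^k times the k-th elementary
  symmetric polynomial of \<open>R\<close>. As power series, the factors have geometric series as
  inverses and the logarithmic derivative makes sense.\<close>

definition linear_factors :: "'a::field set \<Rightarrow> 'a fps" where
  "linear_factors R = (\<Prod>w\<in>R. 1 - fps_const w * fps_X)"

lemma fps_geometric: "(1 - fps_const w * fps_X) * Abs_fps (\<lambda>n. w ^ n) = (1::'a::field fps)"
proof (rule fps_ext)
  fix n show "((1 - fps_const w * fps_X) * Abs_fps (\<lambda>n. w ^ n)) $ n = (1::'a fps) $ n"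
    by (cases n) (simp_all add: algebra_simps)
qed

lemma linear_factors_nth_0 [simp]: "linear_factors R $ 0 = (1::'a::field)"
  unfolding linear_factors_def by (induction R rule: infinite_finite_induct) auto

lemma linear_factors_nth_gt_card:
  assumes "finite R" "card R < n"
  shows "linear_factors R $ n = (0::'a::field)"
  using assms unfolding linear_factors_def
proof (induction R arbitrary: n rule: finite_induct)
  case (insert w R)
  \<comment> \<open>The coefficient of (1 - w X) f at \<open>Suc n'\<close> combines those of f at
    \<open>Suc n'\<close> and \<open>n'\<close>, both beyond \<open>card R\<close>.\<close>
  then obtain n' where "n = Suc n'" "card R < n'" by (cases n) auto
  with insert show ?case by (simp add: algebra_simps)
qed auto

text \<open>The sum is the \<open>n\<close>-th coefficient of \<open>linear_factors R\<close> times the geometric series in \<open>w X\<close>,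
  which cancels the factor \<open>1 - w X\<close> and leaves a polynomial of degree below \<open>n\<close>.\<close>

lemma linear_factors_root:
  fixes R :: "'a::field set"
  assumes "finite R" "card R \<le> n" "w \<in> R"
  shows "(\<Sum>k\<le>n. linear_factors R $ k * w ^ (n - k)) = 0"
proof -
  let ?geo = "Abs_fps (\<lambda>n. w ^ n)"
  have "linear_factors R = (1 - fps_const w * fps_X) * linear_factors (R - {w})"
    using assms by (simp add: linear_factors_def prod.remove)
  then have "linear_factors R * ?geo = (1 - fps_const w * fps_X) * ?geo * linear_factors (R - {w})"
    by (simp add: mult_ac)
  then have "linear_factors R * ?geo = linear_factors (R - {w})"
    by (simp add: fps_geometric)
  moreover have "card (R - {w}) < n"
    using assms by (metis card_Diff1_less order_less_le_trans)
  ultimately have "(linear_factors R * ?geo) $ n = 0"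
    using assms by (simp add: linear_factors_nth_gt_card)
  then show ?thesis by (simp add: fps_mult_nth atLeast0AtMost)
qed

text \<open>This is the logarithmic derivative: the factor 1 - w X contributes -w / (1 - w X), the
  series with coefficients -w^(n+1).\<close>

lemma linear_factors_deriv:
  fixes R :: "'a::field set"
  assumes "finite R"
  shows "fps_deriv (linear_factors R)
    = - (linear_factors R * Abs_fps (\<lambda>n. \<Sum>w\<in>R. w ^ Suc n))"
  using assms
proof (induction R rule: finite_induct)
  case empty
  have "Abs_fps (\<lambda>n. 0) = (0::'a fps)" by (rule fps_ext) simp
  then show ?case by (simp add: linear_factors_def)
next
  case (insert w R)
  let ?l = "1 - fps_const w * fps_X" and ?f = "linear_factors R"
  let ?Q = "Abs_fps (\<lambda>n. \<Sum>w\<in>R. w ^ Suc n)" and ?geo = "Abs_fps (\<lambda>n. w ^ n)"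
  have split: "linear_factors (insert w R) = ?l * ?f"
    using insert by (simp add: linear_factors_def)
  have Q: "Abs_fps (\<lambda>n. \<Sum>w\<in>insert w R. w ^ Suc n) = fps_const w * ?geo + ?Q"
    using insert by (intro fps_ext) simp
  have "?l * ?f * (fps_const w * ?geo + ?Q) = ?l * ?geo * (fps_const w * ?f) + ?l * (?f * ?Q)"
    by (simp only: algebra_simps)
  then have "?l * ?f * (fps_const w * ?geo + ?Q) = fps_const w * ?f + ?l * (?f * ?Q)"
    by (simp add: fps_geometric)
  then show ?case
    unfolding split Q by (simp add: insert.IH flip: fps_const_neg)
qed

text \<open>Compares coefficients of X^n in the derivative formula. Without division, this holds in
  every characteristic.\<close>

lemma newton_identity:
  fixes R :: "'a::field set"
  assumes "finite R"
  shows "of_nat (Suc n) * linear_factors R $ Suc n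
    = - (\<Sum>i\<le>n. linear_factors R $ i * (\<Sum>w\<in>R. w ^ (Suc n - i)))"
proof -
  have "of_nat (Suc n) * linear_factors R $ Suc n = fps_deriv (linear_factors R) $ n" by simp
  also have "\<dots> = - (\<Sum>i\<le>n. linear_factors R $ i * (\<Sum>w\<in>R. w ^ Suc (n - i)))"
    using assms by (simp add: linear_factors_deriv fps_mult_nth atLeast0AtMost)
  also have "\<dots> = - (\<Sum>i\<le>n. linear_factors R $ i * (\<Sum>w\<in>R. w ^ (Suc n - i)))"
    by (simp add: Suc_diff_le)
  finally show ?thesis .
qed

text \<open>Newton's identities solved for the coefficients of \<open>linear_factors\<close>, with \<open>P k\<close> in place of the
  \<open>k\<close>-th power sum. The recursion is meaningful only below the characteristic; beyond it
  \<open>- 1 / of_nat (Suc n)\<close> may be \<open>0\<close>.\<close>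

fun newton :: "(nat \<Rightarrow> 'a::field poly3) \<Rightarrow> nat \<Rightarrow> 'a poly3" where
  "newton P 0 = 1"
| "newton P (Suc n) =
    Poly_Mapping.single (0, 0, 0) (- 1 / of_nat (Suc n)) * (\<Sum>i\<le>n. newton P i * P (Suc n - i))"

lemma homogeneous3_newton:
  assumes "\<And>k. homogeneous3 k (P k)"
  shows "homogeneous3 k (newton P k)"
proof (induction k rule: less_induct)
  case (less k)
  show ?case
  proof (cases k)
    case (Suc n)
    have "homogeneous3 (Suc n) (newton P i * P (Suc n - i))" if "i \<le> n" for i
      using homogeneous3_mult[OF less[of i] assms[of "Suc n - i"]] that Suc by simp
    \<comment> \<open>The scalar factor is a form of degree 0, hence the shape of the sum.\<close>
    then have "homogeneous3 (0 + Suc n) (newton P (Suc n))"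
      unfolding newton.simps
      by (intro homogeneous3_mult homogeneous3_sum homogeneous3_single) auto
    then show ?thesis using Suc by simp
  qed simp
qed

text \<open>Both sides start at 1 and satisfy the same recursion, since \<open>of_nat k\<close> is
  invertible for 0 < k <= n.\<close>

lemma eval3_newton:
  fixes R :: "'a::field set"
  assumes "finite R"
    and "\<And>k. 0 < k \<Longrightarrow> k \<le> n \<Longrightarrow> eval3 (P k) u v w = (\<Sum>x\<in>R. x ^ k)"
    and "\<And>k. 0 < k \<Longrightarrow> k \<le> n \<Longrightarrow> of_nat k \<noteq> (0::'a)"
    and "k \<le> n"
  shows "eval3 (newton P k) u v w = linear_factors R $ k"
  using assms(4)
proof (induction k rule: less_induct)
  case (less k)
  show ?case
  proof (cases k)
    case (Suc m)
    have "eval3 (newton P k) u v w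
        = - 1 / of_nat k * (\<Sum>i\<le>m. linear_factors R $ i * (\<Sum>w\<in>R. w ^ (k - i)))"
      unfolding Suc newton.simps eval3_mult eval3_sum
      using less Suc assms(2) by (auto intro!: sum.cong)
    also have "\<dots> = of_nat k * linear_factors R $ k / of_nat k"
      unfolding Suc newton_identity[OF assms(1)] by simp
    also have "\<dots> = linear_factors R $ k"
      using assms(3)[of k] less Suc by simp
    finally show ?thesis .
  qed simp
qed

section \<open>Sums over a finite field and its characteristic\<close>

text \<open>Multiplication by a nonzero a permutes the field and scales the sum by a^k. Some such a
  has a^k distinct from 1, because X^k - 1 has at most k < q - 1 roots.\<close>

lemma sum_field_power:
  fixes k :: nat
  assumes "0 < k" "k < CARD('a::{field, finite}) - 1"
  shows "(\<Sum>x\<in>(UNIV::'a set). x ^ k) = 0"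
proof -
  let ?p = "Polynomial.monom 1 k - 1 :: 'a poly"
  have "poly ?p 0 = - 1" using assms by (simp add: poly_monom)
  then have "?p \<noteq> 0" by auto
  moreover have "Polynomial.degree ?p \<le> k" by (intro degree_diff_le) (auto simp: degree_monom_le)
  ultimately have "card {x. poly ?p x = 0} \<le> k" using card_poly_roots_bound order_trans by blast
  moreover have "card (UNIV - {0::'a}) = CARD('a) - 1" by simp
  ultimately have "\<not> UNIV - {0::'a} \<subseteq> {x. poly ?p x = 0}"
    using assms(2) card_mono[of "{x. poly ?p x = 0}" "UNIV - {0::'a}"] by fastforce
  then obtain a :: 'a where a: "a \<noteq> 0" "a ^ k \<noteq> 1" by (auto simp: poly_monom)
  have "bij ((*) a)"
    using a by (intro bij_betw_byWitness[where f' = "\<lambda>x. x / a"]) auto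
  then have "(\<Sum>x\<in>(UNIV::'a set). x ^ k) = (\<Sum>x\<in>UNIV. (a * x) ^ k)"
    by (simp add: sum.reindex_bij_betw[of "(*) a" UNIV UNIV "\<lambda>x. x ^ k"])
  also have "\<dots> = a ^ k * (\<Sum>x\<in>UNIV. x ^ k)"
    by (simp add: power_mult_distrib sum_distrib_left)
  finally show ?thesis using a by auto
qed

lemma CHAR_finite_field:
  assumes "prime p" "CARD('a::{field, finite}) = p ^ h"
  shows "CHAR('a) = p"
proof -
  have "CHAR('a) dvd p ^ h" using CHAR_dvd_CARD[where 'a='a] assms by simp
  moreover have "prime CHAR('a)"
    by (simp add: prime_CHAR_semidom finite_imp_CHAR_pos)
  ultimately show ?thesis
    using assms(1) primes_dvd_imp_eq prime_dvd_power by blast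
qed

lemma sum_mset_fibres:
  fixes f :: "'b::finite \<Rightarrow> 'a::comm_ring_1"
  shows "(\<Sum>P\<in>#T. f (\<phi> P)) = (\<Sum>w\<in>UNIV. of_nat (size {#P \<in># T. \<phi> P = w#}) * f w)"
proof (induction T)
  case (add P T)
  have "of_nat (size {#Q \<in># add_mset P T. \<phi> Q = w#}) * f w
      = (if w = \<phi> P then f w else 0) + of_nat (size {#Q \<in># T. \<phi> Q = w#}) * f w" for w
    by (auto simp: algebra_simps)
  then show ?case using add by (simp add: sum.distrib del: filter_mset_add_mset)
qed simp

section \<open>Coordinates of points, lines and directions\<close>

lemma proj_point_mem_proj_line:
  fixes x y z u v w :: "'a::field"
  assumes "(x, y, z) \<noteq> (0, 0, 0)"
  shows "proj_point x y z \<in> proj_line u v w \<longleftrightarrow> u * x + v * y + w * z = 0"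
proof
  assume "proj_point x y z \<in> proj_line u v w"
  then obtain x' y' z' where eq: "proj_point x y z = proj_point x' y' z'"
    and 0: "u * x' + v * y' + w * z' = 0"
    by (auto simp: proj_line_def)
  have "(x, y, z) \<in> proj_point x y z"
    by (auto simp: proj_point_def intro!: exI[of _ 1])
  then obtain c where "x = c * x'" "y = c * y'" "z = c * z'"
    unfolding eq by (auto simp: proj_point_def)
  then have "u * x + v * y + w * z = c * (u * x' + v * y' + w * z')"
    by (simp add: algebra_simps)
  then show "u * x + v * y + w * z = 0" using 0 by simp
next
  assume "u * x + v * y + w * z = 0"
  then show "proj_point x y z \<in> proj_line u v w"
    using assms by (auto simp: proj_line_def)
qed

lemma proj_line_scale:
  fixes c :: "'a::field"
  assumes "c \<noteq> 0"
  shows "proj_line (c * u) (c * v) (c * w) = proj_line u v w"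
proof -
  have "c * u * x + c * v * y + c * w * z = c * (u * x + v * y + w * z)" for x y z
    by (simp add: algebra_simps)
  then show ?thesis using assms by (simp add: proj_line_def)
qed

text \<open>Incidence with (v : -u : 0) forces the first two line coordinates to be proportional to
  (u, v). The factor is nonzero off the line at infinity and can be scaled away.\<close>

lemma affine_lines_eq_range:
  fixes u v :: "'a::field"
  assumes uv: "(u, v) \<noteq> (0, 0)"
  shows "affine_lines (proj_point v (- u) 0) = range (proj_line u v)"
proof
  show "affine_lines (proj_point v (- u) 0) \<subseteq> range (proj_line u v)"
  proof
    fix l assume "l \<in> affine_lines (proj_point v (- u) 0)"
    then obtain u' v' w' where l: "l = proj_line u' v' w'" "(u', v', w') \<noteq> (0, 0, 0)"
      and mem: "proj_point v (- u) 0 \<in> proj_line u' v' w'" and ninf: "l \<noteq> line_at_infinity"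
      by (auto simp: affine_lines_def)
    have det: "u' * v = v' * u"
      using mem uv by (subst (asm) proj_point_mem_proj_line) auto
    have nz: "(u', v') \<noteq> (0, 0)"
    proof
      assume "(u', v') = (0, 0)"
      then show False
        using l ninf proj_line_scale[of w' 0 0 1] by (simp add: line_at_infinity_def)
    qed
    obtain c where c: "u' = c * u" "v' = c * v"
    proof (cases "u = 0")
      case True
      then have "u' = (v' / v) * u" "v' = (v' / v) * v" using uv det by auto
      then show ?thesis by (rule that)
    next
      case False
      then have "u' = (u' / u) * u" "v' = (u' / u) * v" using det by (auto simp: field_simps)
      then show ?thesis by (rule that)
    qed
    then have "c \<noteq> 0" using nz by auto
    then have "l = proj_line u v (w' / c)"
      using proj_line_scale[of c u v "w' / c"] l c by simp
    then show "l \<in> range (proj_line u v)" by blast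
  qed
next
  have "proj_line u v w \<noteq> line_at_infinity" for w
  proof
    assume "proj_line u v w = line_at_infinity"
    moreover have "proj_point 1 0 0 \<in> line_at_infinity" "proj_point 0 1 0 \<in> line_at_infinity"
      by (auto simp: line_at_infinity_def proj_point_mem_proj_line)
    ultimately have "proj_point 1 0 0 \<in> proj_line u v w" "proj_point 0 1 0 \<in> proj_line u v w"
      by auto
    then show False using uv by (simp add: proj_point_mem_proj_line)
  qed
  moreover have "proj_point v (- u) 0 \<in> proj_line u v w" for w
    using uv by (subst proj_point_mem_proj_line) auto
  ultimately show "range (proj_line u v) \<subseteq> affine_lines (proj_point v (- u) 0)"
    using uv unfolding affine_lines_def by fastforce
qed

lemma line_at_infinityE:
  fixes d :: "'a::field point"
  assumes "d \<in> line_at_infinity"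
  obtains u v where "(u, v) \<noteq> (0, 0)" "d = proj_point v (- u) 0"
proof -
  have "d = proj_point 0 1 0 \<or> (\<exists>a. d = proj_point 1 a 0)"
    using assms unfolding line_at_infinity_eq by auto
  then show ?thesis
    \<comment> \<open>(0:1:0) arises from u = -1, v = 0, and (1:a:0) from u = -a, v = 1.\<close>
    using that[of "- 1" 0] that[of "- _" 1] by fastforce
qed

lemma proj_line_mem_envelope_lines:
  "(u, v, w) \<noteq> (0, 0, 0) \<Longrightarrow> eval3 g u v w = 0 \<Longrightarrow> proj_line u v w \<in> envelope_lines g"
  by (auto simp: envelope_lines_def)

section \<open>Power sums of the renitent lines and construction of the envelope\<close>

text \<open>Grouping the points by their line through the fixed direction weights w^k by an
  intersection size. These weights live in the field, so only residues modulo the characteristic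
  matter.\<close>

lemma power_sum_two_residues:
  fixes T :: "'a::{field, finite} point multiset"
  assumes T: "\<And>P. P \<in># T \<Longrightarrow> P = proj_point (X P) (Y P) 1"
    and outside: "\<And>w. w \<notin> R \<Longrightarrow> of_nat (intersection_size T (proj_line u v w)) = (m::'a)"
    and inside: "\<And>w. w \<in> R \<Longrightarrow> of_nat (intersection_size T (proj_line u v w)) = m + s"
    and k: "0 < k" "k < CARD('a) - 1"
  shows "(\<Sum>P\<in>#T. (- (u * X P + v * Y P)) ^ k) = s * (\<Sum>w\<in>R. w ^ k)"
proof -
  have "P \<in> proj_line u v w \<longleftrightarrow> - (u * X P + v * Y P) = w" if "P \<in># T" for P w
  proof -
    have "P \<in> proj_line u v w \<longleftrightarrow> u * X P + v * Y P + w * 1 = 0"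
      by (subst T[OF that], rule proj_point_mem_proj_line) simp
    then show ?thesis by (auto simp: add_eq_0_iff)
  qed
  then have N: "size {#P \<in># T. - (u * X P + v * Y P) = w#} = intersection_size T (proj_line u v w)" for w
    unfolding intersection_size_def by (intro arg_cong[of _ _ size] filter_mset_cong) auto
  have "(\<Sum>P\<in>#T. (- (u * X P + v * Y P)) ^ k)
      = (\<Sum>w\<in>UNIV. of_nat (intersection_size T (proj_line u v w)) * w ^ k)"
    using sum_mset_fibres[of "\<lambda>w. w ^ k" "\<lambda>P. - (u * X P + v * Y P)" T] by (simp only: N)
  also have "\<dots> = (\<Sum>w\<in>UNIV. m * w ^ k + (if w \<in> R then s * w ^ k else 0))"
    by (intro sum.cong) (auto simp: outside inside algebra_simps)
  also have "\<dots> = m * (\<Sum>w\<in>UNIV. w ^ k) + s * (\<Sum>w\<in>R. w ^ k)"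
    by (simp add: sum.distrib sum_distrib_left flip: sum.inter_filter sum.inter_restrict)
  finally show ?thesis using sum_field_power[OF k] by simp
qed

theorem theorem2p1:
  fixes p q h :: nat
    and lam :: int
    and T :: "'a::{field, finite} point multiset"
    and E :: "'a point set"
    and m t :: "'a point \<Rightarrow> int"
  assumes "prime p" and "h > 0" and "q = p ^ h" and "CARD('a) = q"
    and "set_mset T \<subseteq> affine_points"
    and "\<forall>d\<in>E. uniform_direction p lam T d"
    and "card E \<le> q"
    and "\<forall>d\<in>E. typical p lam T d (m d)"
    and "0 < lam" and "lam \<le> min (int q - 2) (int p - 1)"
    and "\<forall>d\<in>E. \<forall>l\<in>renitent_lines p T d (m d). [int (intersection_size T l) = t d] (mod int p)"
    and "\<forall>d\<in>E. \<forall>d'\<in>E. [t d - m d = t d' - m d'] (mod int p)"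
  shows "\<exists>g :: 'a poly3. algebraic_envelope (nat lam) g \<and>
           (\<Union>d\<in>E. renitent_lines p T d (m d)) \<subseteq> envelope_lines g"
proof (cases "(\<Union>d\<in>E. renitent_lines p T d (m d)) = {}")
  case True
  \<comment> \<open>Without renitent lines \<open>t d - m d\<close> may vanish modulo p, so the
    division by s is avoided; W^lam is a form of the right degree.\<close>
  have "algebraic_envelope (nat lam) (Poly_Mapping.single (0, 0, nat lam) (1::'a))"
    by (rule algebraic_envelopeI[where u = 0 and v = 0 and w = 1]) (simp_all add: homogeneous3_single)
  with True show ?thesis by auto
next
  case False
  then obtain d0 l0 where d0: "d0 \<in> E" and l0: "l0 \<in> renitent_lines p T d0 (m d0)" by auto
  define n where "n = nat lam"
  define s where "s = (of_int (t d0 - m d0) :: 'a)"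
  have CHAR: "CHAR('a) = p" using assms by (intro CHAR_finite_field) auto
  \<comment> \<open>The first bound makes the power sums of the field vanish up to \<open>n\<close>,
    the second permits the divisions in Newton's identities.\<close>
  have n: "n < CARD('a) - 1" "n < p"
    using assms(4,9,10) by (auto simp: n_def)
  have of_nat_nz: "of_nat k \<noteq> (0::'a)" if "0 < k" "k \<le> n" for k
    using that n by (auto simp: of_nat_eq_0_iff_char_dvd CHAR dest: dvd_imp_le)
  have of_int_cong: "[a = b] (mod int p) \<longleftrightarrow> of_int a = (of_int b :: 'a)" for a b
    by (simp add: of_int_eq_iff_cong_CHAR CHAR)
  have s: "of_int (t d) = of_int (m d) + s" if "d \<in> E" for d
    using assms(12) that d0 by (simp add: of_int_cong s_def algebra_simps)
  \<comment> \<open>The renitent line \<open>l0\<close> has intersection size congruent to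
    \<open>t d0\<close> but not to \<open>m d0\<close>.\<close>
  have "s \<noteq> 0"
    using assms(11) d0 l0 s[OF d0] by (auto simp: of_int_cong renitent_lines_def)
  have "\<forall>P\<in>set_mset T. \<exists>x y. P = proj_point x y 1"
    using assms(5) by (auto simp: affine_points_def)
  then obtain X Y where XY: "\<And>P. P \<in># T \<Longrightarrow> P = proj_point (X P) (Y P) 1" by metis
  \<comment> \<open>The linear form -(a U + b V) gives the w of the line through (a : b : 1). No
    direction enters \<open>S\<close>, so a single envelope serves all of \<open>E\<close>.\<close>
  define S :: "nat \<Rightarrow> 'a poly3" where
    "S k = Poly_Mapping.single (0, 0, 0) (1 / s) *
      (\<Sum>P\<in>#T. (Poly_Mapping.single (1, 0, 0) (- X P) + Poly_Mapping.single (0, 1, 0) (- Y P)) ^ k)" for k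
  have hom_S: "homogeneous3 k (S k)" for k
  proof -
    have "homogeneous3 (0 + k * 1) (S k)"
      unfolding S_def
      by (intro homogeneous3_mult homogeneous3_sum_mset homogeneous3_power homogeneous3_add
          homogeneous3_single) auto
    then show ?thesis by simp
  qed
  have eval_S: "eval3 (S k) u v w = (\<Sum>P\<in>#T. (- (u * X P + v * Y P)) ^ k) / s" for k u v w
    by (simp add: S_def eval3_mult eval3_sum_mset eval3_power eval3_add algebra_simps)
  define g where "g = (\<Sum>k\<le>n. newton S k * Poly_Mapping.single (0, 0, n - k) 1)"
  have eval_g: "eval3 g u v w = (\<Sum>k\<le>n. linear_factors R $ k * w ^ (n - k))"
    if "\<And>k. 0 < k \<Longrightarrow> k \<le> n \<Longrightarrow> eval3 (S k) u v w = (\<Sum>x\<in>R. x ^ k)" for R u v w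
    using eval3_newton[OF _ that of_nat_nz] by (simp add: g_def eval3_sum eval3_mult)
  have "homogeneous3 n (newton S k * Poly_Mapping.single (0, 0, n - k) 1)" if "k \<le> n" for k
    using homogeneous3_mult[OF homogeneous3_newton[OF hom_S] homogeneous3_single[OF refl]] that
    by (metis (no_types, lifting) add_0 le_add_diff_inverse)
  then have "homogeneous3 n g" by (auto simp: g_def intro: homogeneous3_sum)
  \<comment> \<open>At u = v = 0 every \<open>S k\<close> with k > 0 vanishes, matching the power
    sums of the empty set, so only the term k = 0 survives.\<close>
  moreover have "eval3 g 0 0 1 = 1"
    by (subst eval_g[of 0 0 1 "{}"]) (auto simp: eval_S linear_factors_def zero_power)
  ultimately have "algebraic_envelope n g"
    by (intro algebraic_envelopeI[where u = 0 and v = 0 and w = 1]) auto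
  moreover have "l \<in> envelope_lines g" if "d \<in> E" and l: "l \<in> renitent_lines p T d (m d)" for d l
  proof -
    have "d \<in> line_at_infinity" using assms(6) \<open>d \<in> E\<close> by (auto simp: uniform_direction_def)
    then obtain u v where uv: "(u, v) \<noteq> (0, 0)" and d: "d = proj_point v (- u) 0"
      by (rule line_at_infinityE)
    have lines: "affine_lines d = range (proj_line u v)"
      unfolding d using uv by (rule affine_lines_eq_range)
    define R where "R = {w. proj_line u v w \<in> renitent_lines p T d (m d)}"
    have R_iff: "w \<in> R \<longleftrightarrow> \<not> [int (intersection_size T (proj_line u v w)) = m d] (mod int p)" for w
      by (auto simp: R_def renitent_lines_def lines)
    \<comment> \<open>Uniformity gives q - lam <= q - \<open>card R\<close>, hence
      \<open>card R\<close> is at most \<open>n\<close>; the image bound goes in the direction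
      required.\<close>
    have "{l \<in> affine_lines d. [int (intersection_size T l) = m d] (mod int p)} = proj_line u v ` (- R)"
      by (auto simp: lines R_iff)
    moreover have "card (proj_line u v ` (- R)) \<le> card (- R)" by (rule card_image_le) simp
    moreover have "card (- R) = CARD('a) - card R" by (simp add: Compl_eq_Diff_UNIV card_Diff_subset)
    moreover have "card R \<le> CARD('a)" by (rule card_mono) auto
    ultimately have "card R \<le> n"
      using assms(8) \<open>d \<in> E\<close> unfolding typical_def n_def by fastforce
    \<comment> \<open>\<open>S k\<close> does not involve W, so the identity holds for every w and
      \<open>eval_g\<close> applies to all lines of this direction at once.\<close>
    have "eval3 (S k) u v w = (\<Sum>x\<in>R. x ^ k)" if "0 < k" "k \<le> n" for k w
    proof -
      have "(\<Sum>P\<in>#T. (- (u * X P + v * Y P)) ^ k) = s * (\<Sum>x\<in>R. x ^ k)"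
      proof (rule power_sum_two_residues[OF XY])
        fix x assume "x \<notin> R"
        then show "of_nat (intersection_size T (proj_line u v x)) = (of_int (m d) :: 'a)"
          by (simp add: R_iff of_int_cong)
      next
        fix x assume "x \<in> R"
        then show "of_nat (intersection_size T (proj_line u v x)) = of_int (m d) + s"
          using assms(11) \<open>d \<in> E\<close> s[OF \<open>d \<in> E\<close>] by (simp add: R_def of_int_cong)
      qed (use that n in auto)
      then show ?thesis using \<open>s \<noteq> 0\<close> by (simp add: eval_S)
    qed
    then have eval_g_uv: "eval3 g u v w = (\<Sum>k\<le>n. linear_factors R $ k * w ^ (n - k))" for w
      by (rule eval_g)
    obtain w where w: "l = proj_line u v w" "w \<in> R"
      using l by (auto simp: R_def renitent_lines_def lines)
    then show ?thesis
      using uv \<open>card R \<le> n\<close> linear_factors_root[of R n w]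
      by (auto simp: eval_g_uv intro: proj_line_mem_envelope_lines)
  qed
  ultimately show ?thesis unfolding n_def by blast
qed

end
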